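(* Let $\nu$ be a probability measure on $\mathcal{H}$ with $m_2=m_2(\nu)=\sum_{H\in\mathcal{H}}|H|^2\,\nu(H)<\infty$. Then for any $v\in\big(0,\,1/((2d+1)\cdot m_2)\big)$ the trace $\mathcal{S}^v$ of the Poisson zoo at level $v$ almost surely does not percolate.
   Context: $\mathbb{Z}^d$ is viewed as a graph in which nearest neighbour vertices are joined by an edge. $\mathcal{H}$ denotes the set of finite, connected, nonempty subsets of $\mathbb{Z}^d$ that contain the origin; $|H|$ is the cardinality of $H$. A subset of $\mathbb{Z}^d$ percolates if the subgraph it spans has an infinite connected component. Poisson zoo: given a probability measure $\nu$ on $\mathcal{H}$ and $v>0$, let $N^v_{x,H}\sim\mathrm{POI}(v\cdot\nu(H))$, $x\in\mathbb{Z}^d$, $H\in\mathcal{H}$, be independent Poisson random variables. The trace of the Poisson zoo at level $v$ is the random set $\mathcal{S}^v:=\bigcup_{x\in\mathbb{Z}^d}\bigcup_{H\in\mathcal{H}:\,N^v_{x,H}\geq1}(x+H)$. *)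

theory Defs
  imports "HOL-Probability.Probability" "HOL-Analysis.Analysis"
begin

text \<open>
  The lattice of dimension \<open>d = CARD('d) \<ge> 1\<close> is the type \<^typ>\<open>int ^ 'd\<close>.
\<close>

definition neighbours :: "int ^ 'd \<Rightarrow> int ^ 'd \<Rightarrow> bool" where
  "neighbours x y \<longleftrightarrow> (\<Sum>i\<in>UNIV. \<bar>x $ i - y $ i\<bar>) = 1"

definition spanned_edges :: "(int ^ 'd) set \<Rightarrow> (int ^ 'd) rel" where
  "spanned_edges S = {(x, y). x \<in> S \<and> y \<in> S \<and> neighbours x y}"

definition component_of :: "(int ^ 'd) set \<Rightarrow> int ^ 'd \<Rightarrow> (int ^ 'd) set" where
  "component_of S x = {y \<in> S. (x, y) \<in> (spanned_edges S)\<^sup>*}"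

text \<open>The prefix avoids a clash with the topological notion \<^const>\<open>connected\<close>.\<close>

definition lattice_connected :: "(int ^ 'd) set \<Rightarrow> bool" where
  "lattice_connected S \<longleftrightarrow> (\<forall>x\<in>S. \<forall>y\<in>S. (x, y) \<in> (spanned_edges S)\<^sup>*)"

definition percolates :: "(int ^ 'd) set \<Rightarrow> bool" where
  "percolates S \<longleftrightarrow> (\<exists>x\<in>S. infinite (component_of S x))"

definition animals :: "(int ^ 'd) set set" where
  "animals = {H. finite H \<and> H \<noteq> {} \<and> lattice_connected H \<and> 0 \<in> H}"

text \<open>
  As \<^const>\<open>animals\<close> is countable, a probability measure on it is a \<open>pmf\<close> whose support
  consists of animals. Being a real-valued \<^const>\<open>infsum\<close>, the second moment is \<open>0\<close> when the
  series diverges, so it is meaningful only together with summability.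
\<close>

definition finite_second_moment :: "(int ^ 'd) set pmf \<Rightarrow> bool" where
  "finite_second_moment \<nu> \<longleftrightarrow> (\<lambda>H. (real (card H))\<^sup>2 * pmf \<nu> H) summable_on animals"

definition second_moment :: "(int ^ 'd) set pmf \<Rightarrow> real" where
  "second_moment \<nu> = (\<Sum>\<^sub>\<infinity>H\<in>animals. (real (card H))\<^sup>2 * pmf \<nu> H)"

text \<open>
  \<^const>\<open>poisson_pmf\<close> is specified only for positive rates, but animals outside the support
  of \<open>\<nu>\<close> get rate \<open>0\<close>, for which the Poisson distribution is the point mass at \<open>0\<close>.
\<close>

definition POI :: "real \<Rightarrow> nat pmf" where
  "POI r = (if r = 0 then return_pmf 0 else poisson_pmf r)"

definition poisson_zoo ::
  "'w measure \<Rightarrow> real \<Rightarrow> (int ^ 'd) set pmf \<Rightarrow> (int ^ 'd \<Rightarrow> (int ^ 'd) set \<Rightarrow> 'w \<Rightarrow> nat) \<Rightarrow> bool"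
where
  "poisson_zoo M v \<nu> N \<longleftrightarrow>
     prob_space M \<and>
     prob_space.indep_vars M (\<lambda>_. count_space UNIV) (\<lambda>(x, H). N x H) (UNIV \<times> animals) \<and>
     (\<forall>x. \<forall>H\<in>animals.
        distr M (count_space UNIV) (N x H) = measure_pmf (POI (v * pmf \<nu> H)))"

definition zoo_trace ::
  "(int ^ 'd \<Rightarrow> (int ^ 'd) set \<Rightarrow> 'w \<Rightarrow> nat) \<Rightarrow> 'w \<Rightarrow> (int ^ 'd) set"
where
  "zoo_trace N \<omega> = (\<Union>x. \<Union>H\<in>{H \<in> animals. N x H \<omega> \<ge> 1}. (+) x ` H)"

end

theory Submission
  imports Defs
begin

text \<open>
  Call a pair \<open>(x, H)\<close> with \<open>N x H \<ge> 1\<close> a present animal. Walking inside the trace away from a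
  site \<open>y\<close> means passing from present animal to present animal, each one having a point in the
  closed neighbourhood of some point of its predecessor. The component of \<open>y\<close> is therefore
  covered by the animals reached in this way, and it suffices that these are almost surely finite
  in number.

  The number of reached animals is controlled by counting chains of pairwise distinct present
  animals. For a site \<open>y\<close> and an animal \<open>H\<close>, at most \<open>(2d+1) |H|\<close> translates of \<open>H\<close> have a point in
  the closed neighbourhood of \<open>y\<close>, since that neighbourhood has \<open>2d+1\<close> points. As \<open>(x, H)\<close> is present
  with probability at most \<open>v \<nu>(H)\<close>, the expected total size of the present animals that touch \<open>y\<close> is
  at most \<open>q = v (2d+1) m\<^sub>2\<close>: one factor \<open>|H|\<close> counts the translates, the other one is the
  number of sites from which the chain can go on. Distinct animals are present independently, so
  by induction a chain of length \<open>n\<close> starts at \<open>y\<close> with probability at most \<open>q ^ n\<close>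
  (\<open>emeasure_chain_le\<close>). Since \<open>q < 1\<close>, almost surely some length \<open>n\<close> is not attained.

  A bound on the length of chains gives finiteness as soon as only finitely many present animals
  touch any given site. This holds almost surely because their expected number is at most \<open>q\<close>.
  The distinctness of the animals in a chain is no restriction, because loops can be erased:
  \<open>rtrancl_link_avoid\<close> turns this into a recursion in which the animals already used are
  forbidden, and \<open>finite_reach\<close> is an induction along it.

  The exploration is carried out for independent events indexed by a countable set, each event
  carrying a finite nonempty body. The lattice and the Poisson law enter only through the bound on
  the expected total size of the present bodies that touch a site.
\<close>

section \<open>Countable families of events\<close>

lemma emeasure_UN_le_nn_integral:
  assumes "countable I" and sets: "\<And>i. i \<in> I \<Longrightarrow> X i \<in> sets M"
  shows "emeasure M (\<Union>i\<in>I. X i) \<le> (\<integral>\<^sup>+i. emeasure M (X i) \<partial>count_space I)"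
proof -
  have UN: "(\<Union>i\<in>I. X i) \<in> sets M"
    using assms by (intro sets.countable_UN') auto
  have "emeasure M (\<Union>i\<in>I. X i) = (\<integral>\<^sup>+\<omega>. indicator (\<Union>i\<in>I. X i) \<omega> \<partial>M)"
    using UN by simp
  also have "\<dots> \<le> (\<integral>\<^sup>+\<omega>. \<integral>\<^sup>+i. indicator (X i) \<omega> \<partial>count_space I \<partial>M)"
  proof (rule nn_integral_mono)
    fix \<omega>
    show "(indicator (\<Union>i\<in>I. X i) \<omega> :: ennreal) \<le> (\<integral>\<^sup>+i. indicator (X i) \<omega> \<partial>count_space I)"
    proof (cases "\<omega> \<in> (\<Union>i\<in>I. X i)")
      case True
      then obtain j where j: "j \<in> I" "\<omega> \<in> X j" by auto
      have "(1::ennreal) = (\<integral>\<^sup>+i. indicator {j} i \<partial>count_space I)"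
        using j by simp
      also have "\<dots> \<le> (\<integral>\<^sup>+i. indicator (X i) \<omega> \<partial>count_space I)"
        using j by (intro nn_integral_mono) (auto split: split_indicator)
      finally show ?thesis using True by simp
    qed simp
  qed
  also have "\<dots> = (\<integral>\<^sup>+i. \<integral>\<^sup>+\<omega>. indicator (X i) \<omega> \<partial>M \<partial>count_space I)"
    using assms by (intro nn_integral_count_space_nn_integral) auto
  also have "\<dots> = (\<integral>\<^sup>+i. emeasure M (X i) \<partial>count_space I)"
    using sets by (intro nn_integral_cong) simp
  finally show ?thesis .
qed

text \<open>
  The first Borel-Cantelli lemma for an arbitrary countable index set: an integrable number of
  occurring events is almost surely finite.
\<close>

lemma AE_finite_events_if_expected_number_finite:
  assumes "countable I" and sets: "\<And>i. i \<in> I \<Longrightarrow> X i \<in> sets M"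
    and fin: "(\<integral>\<^sup>+i. emeasure M (X i) \<partial>count_space I) < \<infinity>"
  shows "AE \<omega> in M. finite {i \<in> I. \<omega> \<in> X i}"
proof -
  let ?K = "\<lambda>\<omega>. \<integral>\<^sup>+i. indicator (X i) \<omega> \<partial>count_space I :: ennreal"
  have K: "?K \<omega> = emeasure (count_space I) {i \<in> I. \<omega> \<in> X i}" for \<omega>
  proof -
    have "?K \<omega> = (\<integral>\<^sup>+i. indicator {i \<in> I. \<omega> \<in> X i} i \<partial>count_space I)"
      by (intro nn_integral_cong) (auto split: split_indicator)
    then show ?thesis by simp
  qed
  have "(\<integral>\<^sup>+\<omega>. ?K \<omega> \<partial>M) = (\<integral>\<^sup>+i. \<integral>\<^sup>+\<omega>. indicator (X i) \<omega> \<partial>M \<partial>count_space I)"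
    using assms by (intro nn_integral_count_space_nn_integral) auto
  also have "\<dots> = (\<integral>\<^sup>+i. emeasure M (X i) \<partial>count_space I)"
    using sets by (intro nn_integral_cong) simp
  finally have int: "(\<integral>\<^sup>+\<omega>. ?K \<omega> \<partial>M) \<noteq> \<infinity>"
    using fin by auto
  have meas: "?K \<in> borel_measurable M"
  proof -
    interpret sigma_finite_measure "count_space I"
      using \<open>countable I\<close> by (rule sigma_finite_measure_count_space_countable)
    have "(\<lambda>(i, \<omega>). indicator (X i) \<omega> :: ennreal) \<in> borel_measurable (count_space I \<Otimes>\<^sub>M M)"
      using \<open>countable I\<close> sets by (intro measurable_pair_measure_countable1) auto
    then have "(\<lambda>(\<omega>, i). indicator (X i) \<omega> :: ennreal) \<in> borel_measurable (M \<Otimes>\<^sub>M count_space I)"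
      by (subst measurable_pair_swap_iff) (simp add: split_beta')
    then show ?thesis
      by (intro borel_measurable_nn_integral) (simp add: split_beta')
  qed
  have "AE \<omega> in M. ?K \<omega> \<noteq> \<infinity>"
    by (rule nn_integral_PInf_AE[OF meas int])
  then show ?thesis
  proof (rule AE_mp, intro AE_I2 impI)
    fix \<omega> assume "?K \<omega> \<noteq> \<infinity>"
    then show "finite {i \<in> I. \<omega> \<in> X i}"
      unfolding K by (cases "finite {i \<in> I. \<omega> \<in> X i}") auto
  qed
qed

section \<open>Exploration of a cluster of random bodies\<close>

text \<open>
  Body \<open>i\<close> is present when the event \<open>E i\<close> occurs, and \<open>near y z\<close> says that an exploration standing
  at \<open>y\<close> sees \<open>z\<close>.
\<close>

locale random_bodies = prob_space M
  for M :: "'w measure" +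
  fixes I :: "'i set"
    and E :: "'i \<Rightarrow> 'w set"
    and body :: "'i \<Rightarrow> 'a::countable set"
    and near :: "'a \<Rightarrow> 'a \<Rightarrow> bool"
  assumes countable_I: "countable I"
    and indep: "indep_events E I"
    and body_finite: "i \<in> I \<Longrightarrow> finite (body i)"
    and body_nonempty: "i \<in> I \<Longrightarrow> body i \<noteq> {}"
begin

definition touching :: "'a \<Rightarrow> 'i set" where
  "touching y = {i \<in> I. \<exists>z\<in>body i. near y z}"

definition active :: "'w \<Rightarrow> 'i set" where
  "active \<omega> = {i \<in> I. \<omega> \<in> E i}"

text \<open>
  The set \<open>F\<close> consists of forbidden indices. In an induction on the length of a chain it holds the
  bodies that have been used already.
\<close>

definition link :: "'w \<Rightarrow> 'i set \<Rightarrow> 'i rel" where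
  "link \<omega> F = {(i, j). i \<in> active \<omega> - F \<and> j \<in> active \<omega> - F \<and> (\<exists>y\<in>body i. j \<in> touching y)}"

definition reach :: "'w \<Rightarrow> 'i set \<Rightarrow> 'a set \<Rightarrow> 'i set" where
  "reach \<omega> F B = {j. \<exists>y\<in>B. \<exists>i\<in>touching y. i \<in> active \<omega> - F \<and> (i, j) \<in> (link \<omega> F)\<^sup>*}"

text \<open>
  The event that all bodies of \<open>F\<close> are present and that a chain of \<open>n\<close> further present bodies
  starts at some site of \<open>B\<close>, each body touching its predecessor and all of them distinct and
  outside \<open>F\<close>. Presence is only required at the end, when \<open>F\<close> has collected the whole chain. Hence
  independence is needed for nothing but a finite intersection of events \<open>E i\<close>.
\<close>

primrec chain :: "nat \<Rightarrow> 'i set \<Rightarrow> 'a set \<Rightarrow> 'w set" where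
  "chain 0 F B = {\<omega> \<in> space M. F \<subseteq> active \<omega>}"
| "chain (Suc n) F B = (\<Union>y\<in>B. \<Union>i\<in>touching y - F. chain n (insert i F) (body i))"

lemma touching_subset: "touching y \<subseteq> I"
  by (auto simp: touching_def)

lemma events_E: "i \<in> I \<Longrightarrow> E i \<in> events"
  using indep by (auto simp: indep_events_def)

lemma chain_0:
  assumes "F \<subseteq> I" "F \<noteq> {}"
  shows "chain 0 F B = (\<Inter>i\<in>F. E i)"
  using assms events_E[THEN sets.sets_into_space] by (auto simp: active_def)

lemma emeasure_chain_0:
  assumes "F \<subseteq> I" "finite F"
  shows "emeasure M (chain 0 F B) = (\<Prod>i\<in>F. emeasure M (E i))"
proof (cases "F = {}")
  case True
  then show ?thesis by (simp add: emeasure_space_1)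
next
  case False
  have "prob (\<Inter>i\<in>F. E i) = (\<Prod>i\<in>F. prob (E i))"
    using indep assms False by (auto simp: indep_events_def)
  then show ?thesis
    using chain_0[OF assms(1) False] assms by (simp add: emeasure_eq_measure prod_ennreal)
qed

lemma sets_chain:
  assumes "F \<subseteq> I" "finite F" "finite B"
  shows "chain n F B \<in> events"
  using assms
proof (induction n arbitrary: F B)
  case 0
  show ?case
  proof (cases "F = {}")
    case False
    have "(\<Inter>i\<in>F. E i) \<in> events"
      using 0 events_E False by (intro sets.finite_INT) auto
    then show ?thesis using chain_0[OF 0(1) False] by simp
  qed simp
next
  case (Suc n)
  have "countable (touching y - F)" for y
    using countable_I touching_subset countable_subset by (metis countable_Diff)
  moreover have "chain n (insert i F) (body i) \<in> events" if "i \<in> touching y - F" for i y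
    using that touching_subset Suc.prems body_finite by (intro Suc.IH) auto
  ultimately show ?case
    using \<open>finite B\<close> unfolding chain.simps
    by (intro sets.finite_UN sets.countable_UN') auto
qed

text \<open>
  Union bound over the first body of the chain: going through body \<open>i\<close> costs \<open>emeasure M (E i)\<close>, and
  by induction the rest of the chain contributes a factor proportional to the size of \<open>body i\<close>, so
  the sum over all first bodies touching one site is the quantity bounded by \<open>q\<close>. The size of \<open>B\<close>
  appears because the first body may touch any of its sites.
\<close>

lemma emeasure_chain_le:
  fixes q :: ennreal
  assumes expected: "\<And>y. (\<integral>\<^sup>+i. emeasure M (E i) * card (body i) \<partial>count_space (touching y)) \<le> q"
    and "F \<subseteq> I" "finite F" "finite B" "B \<noteq> {}"
  shows "emeasure M (chain n F B) \<le> (\<Prod>i\<in>F. emeasure M (E i)) * (card B * q ^ n)"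
  using assms(2-)
proof (induction n arbitrary: F B)
  case 0
  then have "1 \<le> card B" by (simp add: Suc_le_eq card_gt_0_iff)
  then have "(\<Prod>i\<in>F. emeasure M (E i)) * 1 \<le> (\<Prod>i\<in>F. emeasure M (E i)) * card B"
    by (intro mult_left_mono) auto
  then show ?case using emeasure_chain_0[OF 0(1,2)] by simp
next
  case (Suc n)
  let ?w = "\<lambda>i. emeasure M (E i)"
  let ?next = "\<lambda>i. chain n (insert i F) (body i)"
  have cnt: "countable (touching y - F)" for y
    using countable_I touching_subset countable_subset by (metis countable_Diff)
  have ev: "?next i \<in> events" if "i \<in> touching y - F" for i y
    using that touching_subset Suc.prems body_finite by (intro sets_chain) auto
  have one: "emeasure M (\<Union>i\<in>touching y - F. ?next i) \<le> prod ?w F * q ^ Suc n" for y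
  proof -
    have "emeasure M (\<Union>i\<in>touching y - F. ?next i)
        \<le> (\<integral>\<^sup>+i. emeasure M (?next i) \<partial>count_space (touching y - F))"
      using cnt ev by (intro emeasure_UN_le_nn_integral) auto
    also have "\<dots> \<le> (\<integral>\<^sup>+i. (prod ?w F * q ^ n) * (?w i * card (body i)) \<partial>count_space (touching y - F))"
    proof (rule nn_integral_mono)
      fix i assume "i \<in> space (count_space (touching y - F))"
      then have i: "i \<in> touching y" "i \<notin> F" "i \<in> I" using touching_subset by auto
      have "emeasure M (?next i) \<le> prod ?w (insert i F) * (card (body i) * q ^ n)"
        using i Suc.prems body_finite body_nonempty by (intro Suc.IH) auto
      then show "emeasure M (?next i) \<le> (prod ?w F * q ^ n) * (?w i * card (body i))"
        using i Suc.prems by (simp add: mult_ac)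
    qed
    also have "\<dots> = (prod ?w F * q ^ n) * (\<integral>\<^sup>+i. ?w i * card (body i) \<partial>count_space (touching y - F))"
      by (intro nn_integral_cmult) simp
    also have "\<dots> \<le> (prod ?w F * q ^ n) * (\<integral>\<^sup>+i. ?w i * card (body i) \<partial>count_space (touching y))"
      by (intro mult_left_mono)
        (auto simp: nn_integral_count_space_indicator intro!: nn_integral_mono split: split_indicator)
    also have "\<dots> \<le> (prod ?w F * q ^ n) * q"
      using expected by (intro mult_left_mono) auto
    finally show ?thesis by (simp add: mult_ac)
  qed
  have "emeasure M (chain (Suc n) F B) \<le> (\<Sum>y\<in>B. emeasure M (\<Union>i\<in>touching y - F. ?next i))"
    unfolding chain.simps using \<open>finite B\<close> cnt ev
    by (intro emeasure_subadditive_finite) (auto intro!: sets.countable_UN')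
  also have "\<dots> \<le> (\<Sum>y\<in>B. prod ?w F * q ^ Suc n)"
    using one by (intro sum_mono)
  also have "\<dots> = prod ?w F * (card B * q ^ Suc n)"
    by (simp add: mult_ac)
  finally show ?case .
qed

text \<open>
  Loop erasure: a path from \<open>i\<close> to \<open>j\<close> may be started after its last visit to \<open>i\<close>, and from
  there on it avoids \<open>i\<close>.
\<close>

lemma rtrancl_link_avoid:
  assumes "(i, j) \<in> (link \<omega> F)\<^sup>*"
  shows "j = i \<or> (\<exists>k. (i, k) \<in> link \<omega> F \<and> k \<noteq> i \<and> (k, j) \<in> (link \<omega> (insert i F))\<^sup>*)"
  using assms
proof (induction rule: rtrancl_induct)
  case (step j l)
  show ?case
  proof (cases "l = i")
    case False
    show ?thesis
      using step.IH
    proof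
      assume "j = i"
      then show ?thesis using step.hyps False by blast
    next
      assume "\<exists>k. (i, k) \<in> link \<omega> F \<and> k \<noteq> i \<and> (k, j) \<in> (link \<omega> (insert i F))\<^sup>*"
      then obtain k where k: "(i, k) \<in> link \<omega> F" "k \<noteq> i" "(k, j) \<in> (link \<omega> (insert i F))\<^sup>*"
        by blast
      show ?thesis
      proof (cases "j = i")
        case True
        then show ?thesis using step.hyps False by blast
      next
        case j: False
        then have "(j, l) \<in> link \<omega> (insert i F)"
          using step.hyps False by (auto simp: link_def)
        then show ?thesis using k by (meson rtrancl.rtrancl_into_rtrancl)
      qed
    qed
  qed simp
qed simp

lemma reach_subset:
  "reach \<omega> F B \<subseteq>
    (\<Union>y\<in>B. \<Union>i\<in>touching y \<inter> active \<omega> - F. insert i (reach \<omega> (insert i F) (body i)))"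
proof
  fix j assume "j \<in> reach \<omega> F B"
  then obtain y i where yi: "y \<in> B" "i \<in> touching y" "i \<in> active \<omega> - F" "(i, j) \<in> (link \<omega> F)\<^sup>*"
    by (auto simp: reach_def)
  have "j \<in> insert i (reach \<omega> (insert i F) (body i))"
    using rtrancl_link_avoid[OF yi(4)] by (fastforce simp: reach_def link_def)
  then show "j \<in> (\<Union>y\<in>B. \<Union>i\<in>touching y \<inter> active \<omega> - F. insert i (reach \<omega> (insert i F) (body i)))"
    using yi by blast
qed

text \<open>
  Without a chain of length \<open>n\<close>, the tree of loop-free explorations has depth below \<open>n\<close>, and it
  branches finitely at every step. At depth \<open>0\<close> nothing is left to show: if the bodies of \<open>F\<close> are
  present, then the chain of length \<open>0\<close> exists.
\<close>

lemma finite_reach: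
  assumes locally_finite: "\<And>y. finite (touching y \<inter> active \<omega>)"
    and "\<omega> \<in> space M" "\<omega> \<notin> chain n F B" "F \<subseteq> active \<omega>" "finite B"
  shows "finite (reach \<omega> F B)"
  using assms(2-)
proof (induction n arbitrary: F B)
  case (Suc n)
  have "finite (reach \<omega> (insert i F) (body i))"
    if "y \<in> B" "i \<in> touching y \<inter> active \<omega> - F" for y i
    using that Suc.prems body_finite[of i] touching_subset[of y] by (intro Suc.IH) auto
  then show ?case
    using Suc.prems locally_finite
    by (intro finite_subset[OF reach_subset]) auto
qed simp

theorem AE_finite_reach:
  fixes q :: real
  assumes expected: "\<And>y. (\<integral>\<^sup>+i. emeasure M (E i) * card (body i) \<partial>count_space (touching y)) \<le> ennreal q"
    and "0 \<le> q" "q < 1"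
  shows "AE \<omega> in M. \<forall>y. finite (reach \<omega> {} {y})"
proof -
  have no_chain: "AE \<omega> in M. \<exists>n. \<omega> \<notin> chain n {} {y}" for y
  proof -
    have le: "emeasure M (\<Inter>n. chain n {} {y}) \<le> ennreal (q ^ n)" for n
    proof -
      have "emeasure M (\<Inter>n. chain n {} {y}) \<le> emeasure M (chain n {} {y})"
        by (intro emeasure_mono sets_chain) auto
      also have "\<dots> \<le> ennreal (q ^ n)"
        using emeasure_chain_le[OF expected, of "{}" "{y}" n] \<open>0 \<le> q\<close> by (simp add: ennreal_power)
      finally show ?thesis .
    qed
    have "(\<lambda>n. ennreal (q ^ n)) \<longlonglongrightarrow> ennreal 0"
      using \<open>0 \<le> q\<close> \<open>q < 1\<close> by (intro tendsto_ennrealI LIMSEQ_power_zero) auto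
    then have "emeasure M (\<Inter>n. chain n {} {y}) \<le> ennreal 0"
      using le by (intro LIMSEQ_le_const) auto
    then have "emeasure M (\<Inter>n. chain n {} {y}) = 0" by simp
    moreover have "(\<Inter>n. chain n {} {y}) \<in> events"
      by (intro sets.countable_INT') (auto intro: sets_chain)
    ultimately show ?thesis
      by (intro AE_I[of _ _ "\<Inter>n. chain n {} {y}"]) auto
  qed
  have local: "AE \<omega> in M. finite (touching y \<inter> active \<omega>)" for y
  proof -
    have "(\<integral>\<^sup>+i. emeasure M (E i) \<partial>count_space (touching y))
        \<le> (\<integral>\<^sup>+i. emeasure M (E i) * card (body i) \<partial>count_space (touching y))"
    proof (rule nn_integral_mono)
      fix i assume "i \<in> space (count_space (touching y))"
      then have "i \<in> I" using touching_subset by auto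
      then have "1 \<le> card (body i)"
        using body_finite body_nonempty by (simp add: Suc_le_eq card_gt_0_iff)
      then have "emeasure M (E i) * 1 \<le> emeasure M (E i) * card (body i)"
        by (intro mult_left_mono) auto
      then show "emeasure M (E i) \<le> emeasure M (E i) * card (body i)" by simp
    qed
    also have "\<dots> < \<infinity>"
      using expected[of y] by (rule order_le_less_trans) simp
    finally have "AE \<omega> in M. finite {i \<in> touching y. \<omega> \<in> E i}"
      using countable_I touching_subset countable_subset events_E
      by (intro AE_finite_events_if_expected_number_finite) blast+
    moreover have "{i \<in> touching y. \<omega> \<in> E i} = touching y \<inter> active \<omega>" for \<omega>
      using touching_subset by (auto simp: active_def)
    ultimately show ?thesis by simp
  qed
  have "AE \<omega> in M. \<forall>y. (\<exists>n. \<omega> \<notin> chain n {} {y}) \<and> finite (touching y \<inter> active \<omega>)"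
    using no_chain local by (simp add: AE_all_countable AE_conj_iff)
  then show ?thesis
  proof (rule AE_mp, intro AE_I2 impI allI)
    fix \<omega> y
    assume \<omega>: "\<omega> \<in> space M"
      "\<forall>y. (\<exists>n. \<omega> \<notin> chain n {} {y}) \<and> finite (touching y \<inter> active \<omega>)"
    then show "finite (reach \<omega> {} {y})"
      using finite_reach[of \<omega> _ "{}" "{y}"] by auto
  qed
qed

end


section \<open>Translates of an animal that touch a site\<close>

definition closed_neighbourhood :: "int ^ 'd \<Rightarrow> (int ^ 'd) set" where
  "closed_neighbourhood y = {z. z = y \<or> neighbours y z}"

lemma neighbours_imp_axis:
  fixes y z :: "int ^ 'd"
  assumes "neighbours y z"
  shows "\<exists>i. \<exists>s\<in>{1, -1}. z = y + axis i s"
proof -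
  let ?f = "\<lambda>i. \<bar>y $ i - z $ i\<bar>"
  have sum: "(\<Sum>i\<in>UNIV. ?f i) = 1"
    using assms by (simp add: neighbours_def)
  have "\<exists>i. ?f i \<noteq> 0"
  proof (rule ccontr)
    assume "\<nexists>i. ?f i \<noteq> 0"
    then have "(\<Sum>i\<in>UNIV. ?f i) = 0" by (intro sum.neutral) blast
    then show False using sum by linarith
  qed
  then obtain i where i: "?f i \<noteq> 0" by blast
  have split: "(\<Sum>i\<in>UNIV. ?f i) = ?f i + (\<Sum>j\<in>UNIV - {i}. ?f j)"
    by (simp add: sum.remove)
  have rest: "(\<Sum>j\<in>UNIV - {i}. ?f j) \<ge> 0"
    by (intro sum_nonneg) simp
  with i sum split have fi: "?f i = 1" and "(\<Sum>j\<in>UNIV - {i}. ?f j) = 0"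
    by linarith+
  then have zero: "?f j = 0" if "j \<noteq> i" for j
    using that by (subst (asm) sum_nonneg_eq_0_iff) auto
  have "z = y + axis i (z $ i - y $ i)"
    using zero by (auto simp: vec_eq_iff axis_def)
  moreover have "z $ i - y $ i \<in> {1, -1}"
    using fi by auto
  ultimately show ?thesis by blast
qed

lemma closed_neighbourhood_bounds:
  fixes y :: "int ^ 'd"
  shows "finite (closed_neighbourhood y)"
    and "card (closed_neighbourhood y) \<le> 2 * CARD('d) + 1"
proof -
  let ?steps = "(\<lambda>(i, s). y + axis i s) ` (UNIV \<times> {1, -1} :: ('d \<times> int) set)"
  have sub: "closed_neighbourhood y \<subseteq> insert y ?steps"
    using neighbours_imp_axis[of y] by (fastforce simp: closed_neighbourhood_def)
  then show "finite (closed_neighbourhood y)"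
    by (rule finite_subset) simp
  have "card (closed_neighbourhood y) \<le> card (insert y ?steps)"
    using sub by (intro card_mono) auto
  also have "\<dots> \<le> Suc (card ?steps)"
    by (simp add: card_insert_if)
  also have "card ?steps \<le> card (UNIV \<times> {1, -1} :: ('d \<times> int) set)"
    by (intro card_image_le) simp
  also have "\<dots> = 2 * CARD('d)"
    by (simp add: card_cartesian_product)
  finally show "card (closed_neighbourhood y) \<le> 2 * CARD('d) + 1" by simp
qed

text \<open>
  A translate of \<open>H\<close> that touches \<open>y\<close> is determined by the touched point \<open>u\<close> of the closed
  neighbourhood and the point \<open>h\<close> of \<open>H\<close> that is moved there: the translation is by \<open>u - h\<close>.
\<close>

lemma translates_touching_bounds:
  fixes y :: "int ^ 'd"
  assumes "finite H"
  shows "finite {x. \<exists>z\<in>(+) x ` H. z \<in> closed_neighbourhood y}"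
    and "card {x. \<exists>z\<in>(+) x ` H. z \<in> closed_neighbourhood y} \<le> (2 * CARD('d) + 1) * card H"
proof -
  let ?T = "{x. \<exists>z\<in>(+) x ` H. z \<in> closed_neighbourhood y}"
  let ?P = "closed_neighbourhood y \<times> H"
  have sub: "?T \<subseteq> (\<lambda>(u, h). u - h) ` ?P"
  proof
    fix x assume "x \<in> ?T"
    then obtain h where h: "h \<in> H" "x + h \<in> closed_neighbourhood y" by blast
    then show "x \<in> (\<lambda>(u, h). u - h) ` ?P"
      by (intro image_eqI[of _ _ "(x + h, h)"]) auto
  qed
  have fin: "finite ?P"
    using assms closed_neighbourhood_bounds by blast
  show "finite ?T"
    using sub fin by (meson finite_imageI finite_subset)
  have "card ?T \<le> card ?P"
    using surj_card_le[OF fin sub] .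
  also have "\<dots> \<le> (2 * CARD('d) + 1) * card H"
    unfolding card_cartesian_product by (intro mult_right_mono closed_neighbourhood_bounds) simp
  finally show "card ?T \<le> (2 * CARD('d) + 1) * card H" .
qed

section \<open>The Poisson zoo\<close>

lemma prob_POI_positive_le:
  assumes "0 \<le> r"
  shows "emeasure (measure_pmf (POI r)) {n. 1 \<le> n} \<le> ennreal r"
proof -
  have "{n. 1 \<le> n} = UNIV - {0::nat}" by auto
  then have "measure_pmf.prob (POI r) {n. 1 \<le> n} = 1 - pmf (POI r) 0"
    using measure_pmf.prob_compl[of "{0}" "POI r"] by (simp add: measure_pmf_single)
  also have "\<dots> \<le> r"
  proof (cases "r = 0")
    case False
    then show ?thesis
      using assms exp_ge_add_one_self[of "-r"] by (simp add: POI_def)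
  qed (simp add: POI_def)
  finally show ?thesis
    using assms by (simp add: measure_pmf.emeasure_eq_measure)
qed

lemma countable_animals: "countable (animals :: (int ^ 'd) set set)"
  by (rule countable_subset[OF _ countable_Collect_finite]) (auto simp: animals_def)

lemma nn_integral_second_moment:
  assumes "finite_second_moment \<nu>"
  shows "(\<integral>\<^sup>+H. ennreal ((real (card H))\<^sup>2 * pmf \<nu> H) \<partial>count_space animals) = ennreal (second_moment \<nu>)"
proof -
  let ?f = "\<lambda>H. (real (card H))\<^sup>2 * pmf \<nu> H"
  have "(\<lambda>H. norm (?f H)) summable_on animals"
    using assms by (simp add: finite_second_moment_def)
  then have "Infinite_Set_Sum.abs_summable_on ?f animals"
    by (simp only: abs_summable_equivalent)
  then show ?thesis
    by (simp add: nn_integral_conv_infsetsum infsetsum_infsum second_moment_def)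
qed

locale poisson_zoo_model =
  fixes \<nu> :: "(int ^ 'd) set pmf"
    and M :: "'w measure"
    and N :: "int ^ 'd \<Rightarrow> (int ^ 'd) set \<Rightarrow> 'w \<Rightarrow> nat"
    and v :: real
  assumes zoo: "poisson_zoo M v \<nu> N"
    and moment: "finite_second_moment \<nu>"
    and v_pos: "0 < v"
begin

text \<open>
  The \<open>case\<close> sits outside the application to \<open>\<omega>\<close> so that the events have the shape of the
  independent family of random variables in \<^const>\<open>poisson_zoo\<close>.
\<close>

definition present :: "(int ^ 'd) \<times> (int ^ 'd) set \<Rightarrow> 'w set" where
  "present i = {\<omega> \<in> space M. 1 \<le> (case i of (x, H) \<Rightarrow> N x H) \<omega>}"

definition placed :: "(int ^ 'd) \<times> (int ^ 'd) set \<Rightarrow> (int ^ 'd) set" where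
  "placed i = (case i of (x, H) \<Rightarrow> (+) x ` H)"

sublocale random_bodies M "UNIV \<times> animals" present placed "\<lambda>y z. z \<in> closed_neighbourhood y"
proof -
  interpret prob_space M
    using zoo by (simp add: poisson_zoo_def)
  have "indep_vars (\<lambda>_. count_space UNIV) (\<lambda>(x, H). N x H) (UNIV \<times> animals)"
    using zoo by (simp add: poisson_zoo_def)
  then have "indep_events present (UNIV \<times> animals)"
    unfolding present_def by (rule indep_eventsI_indep_vars) auto
  then show "random_bodies M (UNIV \<times> animals) present placed"
    using countable_animals
    by unfold_locales (auto simp: placed_def animals_def)
qed

lemma prob_present_le:
  assumes "H \<in> animals"
  shows "emeasure M (present (x, H)) \<le> ennreal (v * pmf \<nu> H)"
proof -
  have "random_variable (count_space UNIV) (N x H)"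
    using zoo assms by (auto simp: poisson_zoo_def indep_vars_def2)
  then have "emeasure M (present (x, H)) = emeasure (distr M (count_space UNIV) (N x H)) {n. 1 \<le> n}"
    by (subst emeasure_distr) (auto simp: present_def intro!: arg_cong[where f="emeasure M"])
  also have "\<dots> \<le> ennreal (v * pmf \<nu> H)"
    using zoo assms v_pos prob_POI_positive_le[of "v * pmf \<nu> H"] by (simp add: poisson_zoo_def)
  finally show ?thesis .
qed

text \<open>
  This is where the second moment enters: for fixed \<open>H\<close>, one factor \<open>card H\<close> is the size of the
  body and the other one comes from the number of translates that touch \<open>y\<close>.
\<close>

lemma expected_size_touching_le:
  "(\<integral>\<^sup>+i. emeasure M (present i) * card (placed i) \<partial>count_space (touching y))
    \<le> ennreal (v * ((2 * real CARD('d) + 1) * second_moment \<nu>))"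
proof -
  let ?c = "v * (2 * real CARD('d) + 1)"
  let ?T = "\<lambda>H. {x. \<exists>z\<in>(+) x ` H. z \<in> closed_neighbourhood y}"
  let ?g = "\<lambda>x H. ennreal (v * pmf \<nu> H * card H) * indicator animals H * indicator (?T H) x"
  have "(\<integral>\<^sup>+i. emeasure M (present i) * card (placed i) \<partial>count_space (touching y))
      = (\<integral>\<^sup>+i. emeasure M (present i) * card (placed i) * indicator (touching y) i \<partial>count_space UNIV)"
    by (simp add: nn_integral_count_space_indicator)
  also have "\<dots> \<le> (\<integral>\<^sup>+i. ?g (fst i) (snd i) \<partial>count_space UNIV)"
  proof (rule nn_integral_mono)
    fix i :: "(int ^ 'd) \<times> (int ^ 'd) set"
    obtain x H where i: "i = (x, H)" by fastforce
    show "emeasure M (present i) * card (placed i) * indicator (touching y) i \<le> ?g (fst i) (snd i)"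
    proof (cases "i \<in> touching y")
      case True
      then have H: "H \<in> animals" "x \<in> ?T H"
        by (auto simp: touching_def i placed_def)
      have "emeasure M (present i) * card (placed i) \<le> ennreal (v * pmf \<nu> H) * card H"
        using prob_present_le[OF H(1), of x]
        by (auto simp: i placed_def card_image intro!: mult_right_mono)
      also have "\<dots> = ennreal (v * pmf \<nu> H * card H)"
        using v_pos by (simp add: ennreal_mult ennreal_of_nat_eq_real_of_nat)
      finally show ?thesis using True H by (simp add: i)
    qed simp
  qed
  also have "\<dots> = (\<integral>\<^sup>+H. \<integral>\<^sup>+x. ?g x H \<partial>count_space UNIV \<partial>count_space UNIV)"
    by (subst nn_integral_snd_count_space[symmetric]) (simp add: split_beta')
  also have "\<dots> \<le> (\<integral>\<^sup>+H. ennreal ?c * ennreal ((real (card H))\<^sup>2 * pmf \<nu> H) * indicator animals H \<partial>count_space UNIV)"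
  proof (rule nn_integral_mono)
    fix H :: "(int ^ 'd) set"
    show "(\<integral>\<^sup>+x. ?g x H \<partial>count_space UNIV)
        \<le> ennreal ?c * ennreal ((real (card H))\<^sup>2 * pmf \<nu> H) * indicator animals H"
    proof (cases "H \<in> animals")
      case True
      then have "finite H" by (simp add: animals_def)
      note T = translates_touching_bounds[OF this, of y]
      have "(\<integral>\<^sup>+x. ?g x H \<partial>count_space UNIV) = ennreal (v * pmf \<nu> H * card H) * card (?T H)"
        using True T(1) by (simp add: nn_integral_cmult)
      also have "\<dots> = ennreal (v * pmf \<nu> H * card H * card (?T H))"
        using v_pos by (simp add: ennreal_mult ennreal_of_nat_eq_real_of_nat)
      also have "\<dots> \<le> ennreal (v * pmf \<nu> H * card H * ((2 * CARD('d) + 1) * card H))"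
        using T(2) v_pos by (intro ennreal_leI mult_left_mono) (simp_all only: of_nat_le_iff, simp)
      also have "v * pmf \<nu> H * card H * ((2 * CARD('d) + 1) * card H)
          = ?c * ((real (card H))\<^sup>2 * pmf \<nu> H)"
        by (simp add: power2_eq_square algebra_simps)
      also have "ennreal \<dots> = ennreal ?c * ennreal ((real (card H))\<^sup>2 * pmf \<nu> H)"
        using v_pos by (intro ennreal_mult) simp_all
      finally show ?thesis using True by simp
    qed simp
  qed
  also have "\<dots> = (\<integral>\<^sup>+H. ennreal ?c * ennreal ((real (card H))\<^sup>2 * pmf \<nu> H) \<partial>count_space animals)"
    by (simp add: nn_integral_count_space_indicator)
  also have "\<dots> = ennreal ?c * ennreal (second_moment \<nu>)"
    by (subst nn_integral_cmult) (simp_all add: nn_integral_second_moment[OF moment])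
  also have "\<dots> = ennreal (v * ((2 * real CARD('d) + 1) * second_moment \<nu>))"
    using v_pos by (simp add: ennreal_mult' [symmetric] mult.assoc)
  finally show ?thesis .
qed

text \<open>
  Consecutive sites of a path in the trace lie in present animals of which the second one touches
  the first one. The closed neighbourhood contains its centre, so that the first site of the path
  is itself seen by the exploration.
\<close>

lemma component_subset_reach:
  assumes "\<omega> \<in> space M"
  shows "component_of (zoo_trace N \<omega>) x \<subseteq> (\<Union>i\<in>reach \<omega> {} {x}. placed i)"
proof
  let ?S = "zoo_trace N \<omega>"
  have S: "\<exists>i\<in>active \<omega>. y \<in> placed i" if "y \<in> ?S" for y
    using that assms by (fastforce simp: zoo_trace_def active_def present_def placed_def)
  have touch: "i \<in> touching y"
    if "i \<in> active \<omega>" "z \<in> placed i" "z \<in> closed_neighbourhood y" for i y z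
    using that by (auto simp: touching_def active_def)
  fix y assume "y \<in> component_of ?S x"
  then have "y \<in> ?S" "(x, y) \<in> (spanned_edges ?S)\<^sup>*"
    by (auto simp: component_of_def)
  from this(2,1) show "y \<in> (\<Union>i\<in>reach \<omega> {} {x}. placed i)"
  proof (induction rule: rtrancl_induct)
    case base
    then obtain i where "i \<in> active \<omega>" "x \<in> placed i"
      using S by blast
    moreover from this have "i \<in> touching x"
      by (intro touch) (auto simp: closed_neighbourhood_def)
    ultimately have "i \<in> reach \<omega> {} {x}" by (auto simp: reach_def)
    then show ?case using \<open>x \<in> placed i\<close> by blast
  next
    case (step y z)
    then have yz: "y \<in> ?S" "z \<in> ?S" "z \<in> closed_neighbourhood y"
      by (auto simp: spanned_edges_def closed_neighbourhood_def)
    obtain i where i: "i \<in> reach \<omega> {} {x}" "y \<in> placed i"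
      using step.IH yz by blast
    obtain j where j: "j \<in> active \<omega>" "z \<in> placed j"
      using S yz by blast
    have "i \<in> active \<omega>"
      using i(1) by (auto simp: reach_def link_def elim: rtranclE)
    moreover have "j \<in> touching y"
      using j yz(3) by (rule touch)
    ultimately have "(i, j) \<in> link \<omega> {}"
      using i j by (auto simp: link_def)
    then have "j \<in> reach \<omega> {} {x}"
      using i(1) unfolding reach_def by (blast intro: rtrancl_into_rtrancl)
    then show ?case using j by blast
  qed
qed

lemma AE_not_percolates:
  assumes "v * ((2 * real CARD('d) + 1) * second_moment \<nu>) < 1"
  shows "AE \<omega> in M. \<not> percolates (zoo_trace N \<omega>)"
proof -
  have "0 \<le> second_moment \<nu>"
    unfolding second_moment_def by (intro infsum_nonneg) simp
  then have "AE \<omega> in M. \<forall>x. finite (reach \<omega> {} {x})"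
    using assms v_pos by (intro AE_finite_reach[OF expected_size_touching_le]) auto
  then show ?thesis
  proof (rule AE_mp, intro AE_I2 impI)
    fix \<omega> assume \<omega>: "\<omega> \<in> space M" "\<forall>x. finite (reach \<omega> {} {x})"
    have "finite (\<Union>i\<in>reach \<omega> {} {x}. placed i)" for x
    proof (intro finite_UN_I)
      fix i assume "i \<in> reach \<omega> {} {x}"
      then have "i \<in> UNIV \<times> animals"
        by (auto simp: reach_def link_def active_def elim: rtranclE)
      then show "finite (placed i)" by (rule body_finite)
    qed (use \<omega> in simp)
    then show "\<not> percolates (zoo_trace N \<omega>)"
      using component_subset_reach[OF \<omega>(1)] finite_subset by (fastforce simp: percolates_def)
  qed
qed

end

theorem lemma1p6:
  fixes \<nu> :: "(int ^ 'd) set pmf"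
    and M :: "'w measure"
    and N :: "int ^ 'd \<Rightarrow> (int ^ 'd) set \<Rightarrow> 'w \<Rightarrow> nat"
    and v :: real
  assumes "set_pmf \<nu> \<subseteq> animals"
    and "finite_second_moment \<nu>"
    and "0 < v"
    and "v < 1 / ((2 * real CARD('d) + 1) * second_moment \<nu>)"
    and "poisson_zoo M v \<nu> N"
  shows "AE \<omega> in M. \<not> percolates (zoo_trace N \<omega>)"
proof -
  interpret poisson_zoo_model \<nu> M N v
    using assms by unfold_locales
  (* As v > 0 lies below it, the reciprocal is positive, which excludes the value 1 / 0 = 0. *)
  let ?D = "(2 * real CARD('d) + 1) * second_moment \<nu>"
  have "0 < 1 / ?D"
    using assms(3,4) by linarith
  then have "v * ?D < 1"
    using assms(4) by (simp add: field_simps)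
  then show ?thesis by (rule AE_not_percolates)
qed

end
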